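(* Let $\Gamma$ be a locally finite graph, $F$ a field with an absolute value $|\cdot|_{\rm v}$, and $\lambda\in F$. Then for every $v\in V(\Gamma)$ the following conditions are equivalent: (i) The operator $A_{\Gamma,F}$ has an eigenfunction corresponding to the eigenvalue $\lambda$ whose support is finite and contains $v$. (ii) The graph $\Gamma$ has no $(F,\lambda)$-propagator with respect to $v$ (in other words, $v\in S_{F,\lambda}(\Gamma)$).
   Context: A graph is an undirected graph without loops or multiple edges, with vertex set $V(\Gamma)$; $\Gamma(v)$ is the set of vertices adjacent to $v$. $\Gamma$ is locally finite if every $\Gamma(v)$ is finite (it may be infinite and disconnected). $F^{V(\Gamma)}$ is the $F$-vector space of all functions $V(\Gamma)\to F$, and $A_{\Gamma,F}:F^{V(\Gamma)}\to F^{V(\Gamma)}$ is the linear operator $(A_{\Gamma,F}(f))(v)=\sum_{u\in\Gamma(v)}f(u)$; $E$ is the identity operator. The absolute value may be trivial. An eigenfunction corresponding to the eigenvalue $\lambda$ is a nonzero $f$ with $A_{\Gamma,F}(f)=\lambda f$. The support of $f$ is $\{u: f(u)\neq 0\}$. $\delta_v\in F^{V(\Gamma)}$ is $1$ at $v$ and $0$ elsewhere. An $(F,\lambda)$-propagator of $\Gamma$ with respect to $v$ is any $f\in F^{V(\Gamma)}$ with $(A_{\Gamma,F}-\lambda E)(f)=\delta_v$. $S_{F,\lambda}(\Gamma)$ is the set of all vertices $v$ with respect to which $\Gamma$ has no $(F,\lambda)$-propagator. *)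

theory Defs
  imports Complex_Main "HOL-Library.FuncSet"
begin

text \<open>A graph is given by its vertex set \<open>V\<close> (possibly infinite) and its set \<open>E\<close> of edges,
  each edge being a two-element subset of \<open>V\<close>.\<close>

locale simple_graph =
  fixes V :: "'v set" and E :: "'v set set"
  assumes edges: "E \<subseteq> {{u, w} | u w. u \<in> V \<and> w \<in> V \<and> u \<noteq> w}"

definition nbrs :: "'v set set \<Rightarrow> 'v \<Rightarrow> 'v set" where
  "nbrs E v = {u. {u, v} \<in> E}"

locale locally_finite_graph = simple_graph V E for V :: "'v set" and E :: "'v set set" +
  assumes locally_finite: "v \<in> V \<Longrightarrow> finite (nbrs E v)"

locale absolute_value =
  fixes av :: "'a::field \<Rightarrow> real"
  assumes nonneg: "av x \<ge> 0"
    and eq_zero_iff: "av x = 0 \<longleftrightarrow> x = 0"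
    and mult: "av (x * y) = av x * av y"
    and triangle: "av (x + y) \<le> av x + av y"

text \<open>The space \<open>F\<^sup>V\<close> is represented by the extensional functions on \<open>V\<close>, so that equality in
  \<open>F\<^sup>V\<close> is equality in HOL; in particular all operators below return extensional functions.\<close>

abbreviation fun_space :: "'v set \<Rightarrow> ('v \<Rightarrow> 'a::field) set" where
  "fun_space V \<equiv> V \<rightarrow>\<^sub>E UNIV"

definition adj_op :: "'v set \<Rightarrow> 'v set set \<Rightarrow> ('v \<Rightarrow> 'a::field) \<Rightarrow> 'v \<Rightarrow> 'a" where
  "adj_op V E f = (\<lambda>v\<in>V. \<Sum>u\<in>nbrs E v. f u)"

definition scale_fun :: "'v set \<Rightarrow> 'a::field \<Rightarrow> ('v \<Rightarrow> 'a) \<Rightarrow> 'v \<Rightarrow> 'a" where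
  "scale_fun V c f = (\<lambda>v\<in>V. c * f v)"

definition diff_fun :: "'v set \<Rightarrow> ('v \<Rightarrow> 'a::field) \<Rightarrow> ('v \<Rightarrow> 'a) \<Rightarrow> 'v \<Rightarrow> 'a" where
  "diff_fun V f g = (\<lambda>v\<in>V. f v - g v)"

definition zero_fun :: "'v set \<Rightarrow> 'v \<Rightarrow> 'a::field" where
  "zero_fun V = (\<lambda>v\<in>V. 0)"

definition delta_fun :: "'v set \<Rightarrow> 'v \<Rightarrow> 'v \<Rightarrow> 'a::field" where
  "delta_fun V v = (\<lambda>u\<in>V. if u = v then 1 else 0)"

definition supp :: "'v set \<Rightarrow> ('v \<Rightarrow> 'a::field) \<Rightarrow> 'v set" where
  "supp V f = {u \<in> V. f u \<noteq> 0}"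

definition eigenfunction ::
    "'v set \<Rightarrow> 'v set set \<Rightarrow> 'a::field \<Rightarrow> ('v \<Rightarrow> 'a) \<Rightarrow> bool" where
  "eigenfunction V E l f \<longleftrightarrow>
     f \<in> fun_space V \<and> f \<noteq> zero_fun V \<and> adj_op V E f = scale_fun V l f"

definition propagator ::
    "'v set \<Rightarrow> 'v set set \<Rightarrow> 'a::field \<Rightarrow> 'v \<Rightarrow> ('v \<Rightarrow> 'a) \<Rightarrow> bool" where
  "propagator V E l v f \<longleftrightarrow>
     f \<in> fun_space V \<and> diff_fun V (adj_op V E f) (scale_fun V l f) = delta_fun V v"

definition no_propagator_set :: "'v set \<Rightarrow> 'v set set \<Rightarrow> 'a::field \<Rightarrow> 'v set" where
  "no_propagator_set V E l = {v \<in> V. \<not> (\<exists>f. propagator V E l v f)}"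

end

theory Submission
  imports Defs "HOL-Library.Function_Algebras"
begin

text \<open>Write \<open>T = A - \<lambda>\<close>. The theorem is linear algebra resting on one duality: the space of all
  functions on \<open>V\<close> is the algebraic dual of the space \<open>W\<close> of finitely supported functions (pair
  them by \<open>\<Sum>u. g u * f u\<close>), and, as adjacency is symmetric and the graph is locally finite, \<open>T\<close> maps
  \<open>W\<close> to itself and \<open>T\<close> on all functions is the transpose of \<open>T\<close> on \<open>W\<close>. A propagator with respect
  to \<open>v\<close> is therefore a functional \<open>\<phi>\<close> on \<open>W\<close> with \<open>\<phi> (T g) = g v\<close> for all \<open>g\<close>.

  Such a \<open>\<phi>\<close> forces \<open>g v = 0\<close> for every \<open>g\<close> in the kernel of \<open>T\<close> on \<open>W\<close>, which excludes a finitely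
  supported eigenfunction that is nonzero at \<open>v\<close>; concretely this is the self-adjointness
  \<open>pairing_symmetric\<close>. Conversely, if every \<open>g \<in> W\<close> with \<open>T g = 0\<close> vanishes at \<open>v\<close>, then \<open>g v\<close>
  depends on \<open>T g\<close> only, and a basis of \<open>T ` W\<close> extended to the whole space gives a linear \<open>\<phi>\<close>; its
  values at the indicator functions of the vertices form the propagator (\<open>dual_solution_exists\<close>).\<close>

text \<open>The operator \<open>T\<close>. The value \<open>0\<close> off \<open>V\<close>, instead of \<open>undefined\<close>, makes it linear on the vector
  space of all functions on the vertex type.\<close>

definition shifted_adj :: "'v set \<Rightarrow> 'v set set \<Rightarrow> 'a::field \<Rightarrow> ('v \<Rightarrow> 'a) \<Rightarrow> 'v \<Rightarrow> 'a" where
  "shifted_adj V E l f = (\<lambda>u. if u \<in> V then (\<Sum>w\<in>nbrs E u. f w) - l * f u else 0)"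

lemma (in simple_graph) nbrs_subset: "nbrs E u \<subseteq> V"
  using edges by (auto simp: nbrs_def doubleton_eq_iff)

lemma nbrs_sym: "u \<in> nbrs E w \<longleftrightarrow> w \<in> nbrs E u"
  by (simp add: nbrs_def insert_commute)

lemma propagator_iff:
  "propagator V E l v f \<longleftrightarrow>
     f \<in> fun_space V \<and> (\<forall>u\<in>V. shifted_adj V E l f u = (if u = v then 1 else 0))"
  by (auto simp: propagator_def diff_fun_def adj_op_def scale_fun_def delta_fun_def
      shifted_adj_def fun_eq_iff restrict_def)

lemma eigenfunction_iff:
  "eigenfunction V E l f \<longleftrightarrow>
     f \<in> fun_space V \<and> supp V f \<noteq> {} \<and> (\<forall>u\<in>V. shifted_adj V E l f u = 0)"
proof -
  have "f \<noteq> zero_fun V \<longleftrightarrow> supp V f \<noteq> {}" if "f \<in> fun_space V"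
    using that by (auto simp: Defs.zero_fun_def supp_def fun_eq_iff PiE_def extensional_def)
  moreover have "adj_op V E f = scale_fun V l f \<longleftrightarrow> (\<forall>u\<in>V. shifted_adj V E l f u = 0)"
    by (auto simp: adj_op_def scale_fun_def shifted_adj_def fun_eq_iff restrict_def)
  ultimately show ?thesis
    by (auto simp: eigenfunction_def)
qed

text \<open>The matrix of \<open>T\<close> is symmetric, so both sides are the same double sum; local finiteness
  confines it to the finite set of vertices that lie in \<open>supp V f\<close> or are adjacent to it.\<close>

lemma (in locally_finite_graph) pairing_symmetric:
  fixes f p :: "'v \<Rightarrow> 'a::field"
  assumes fin: "finite (supp V f)"
  defines "D \<equiv> supp V f \<union> (\<Union>u\<in>supp V f. nbrs E u)"
  shows "(\<Sum>u\<in>D. f u * shifted_adj V E l p u) = (\<Sum>u\<in>D. shifted_adj V E l f u * p u)"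
proof -
  have suppV: "supp V f \<subseteq> V"
    by (auto simp: supp_def)
  have DV: "D \<subseteq> V"
    using suppV nbrs_subset by (auto simp: D_def)
  have finD: "finite D"
    using fin suppV locally_finite by (auto simp: D_def)
  have left: "f u * (\<Sum>w\<in>nbrs E u. p w) = (\<Sum>w\<in>D. if w \<in> nbrs E u then f u * p w else 0)"
    if "u \<in> D" for u
  proof (cases "u \<in> supp V f")
    case True
    then have "D \<inter> nbrs E u = nbrs E u"
      by (auto simp: D_def)
    then show ?thesis
      using finD by (simp add: sum_distrib_left flip: sum.inter_restrict)
  next
    case False
    then have "f u = 0"
      using that DV by (auto simp: supp_def)
    then show ?thesis by (simp cong: if_cong)
  qed
  have right: "(\<Sum>u\<in>nbrs E w. f u) * p w = (\<Sum>u\<in>D. if u \<in> nbrs E w then f u * p w else 0)"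
    if "w \<in> D" for w
  proof -
    have "(\<Sum>u\<in>nbrs E w. f u) = (\<Sum>u\<in>D \<inter> nbrs E w. f u)"
      using locally_finite[of w] that DV nbrs_subset[of w]
      by (intro sum.mono_neutral_right) (auto simp: D_def supp_def)
    then show ?thesis
      using finD by (simp add: sum_distrib_right flip: sum.inter_restrict)
  qed
  have "(\<Sum>u\<in>D. f u * (\<Sum>w\<in>nbrs E u. p w)) =
      (\<Sum>u\<in>D. \<Sum>w\<in>D. if w \<in> nbrs E u then f u * p w else 0)"
    by (simp add: left)
  also have "\<dots> = (\<Sum>w\<in>D. \<Sum>u\<in>D. if u \<in> nbrs E w then f u * p w else 0)"
    by (subst sum.swap) (simp add: nbrs_sym)
  also have "\<dots> = (\<Sum>w\<in>D. (\<Sum>u\<in>nbrs E w. f u) * p w)"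
    by (simp add: right)
  finally have adj: "(\<Sum>u\<in>D. f u * (\<Sum>w\<in>nbrs E u. p w)) = (\<Sum>u\<in>D. (\<Sum>w\<in>nbrs E u. f w) * p u)" .
  have "(\<Sum>u\<in>D. f u * shifted_adj V E l p u) =
      (\<Sum>u\<in>D. f u * (\<Sum>w\<in>nbrs E u. p w)) - (\<Sum>u\<in>D. l * (f u * p u))"
    using DV by (subst sum_subtractf[symmetric], intro sum.cong)
      (auto simp: shifted_adj_def algebra_simps)
  also have "\<dots> = (\<Sum>u\<in>D. shifted_adj V E l f u * p u)"
    using DV by (subst adj, subst sum_subtractf[symmetric], intro sum.cong)
      (auto simp: shifted_adj_def algebra_simps)
  finally show ?thesis .
qed

lemma sum_fun_apply: "(\<Sum>i\<in>I. f i) x = (\<Sum>i\<in>I. f i x)"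
  for f :: "'i \<Rightarrow> 'v \<Rightarrow> 'a::comm_monoid_add"
  by (induction I rule: infinite_finite_induct) simp_all

lemma vector_space_fun: "vector_space (\<lambda>c (f :: 'v \<Rightarrow> 'a::field) x. c * f x)"
  by unfold_locales (auto simp: fun_eq_iff algebra_simps)

text \<open>The values \<open>h (indicator of u) v\<close> of a linear right inverse \<open>h\<close> of \<open>T\<close> on \<open>T ` W\<close> give the
  propagator: \<open>h (T g)\<close> and \<open>g\<close> differ by an element of the kernel, hence agree at \<open>v\<close>.\<close>

lemma (in locally_finite_graph) dual_solution_exists:
  fixes l :: "'a::field"
  assumes ker: "\<And>g. finite {u. g u \<noteq> 0} \<Longrightarrow> {u. g u \<noteq> 0} \<subseteq> V \<Longrightarrow> \<forall>u\<in>V. shifted_adj V E l g u = 0 \<Longrightarrow> g v = 0"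
  shows "\<exists>f. \<forall>u\<in>V. shifted_adj V E l f u = (if u = v then 1 else 0)"
proof -
  let ?s = "\<lambda>c (f :: 'v \<Rightarrow> 'a) x. c * f x"
  let ?T = "shifted_adj V E l"
  define W :: "('v \<Rightarrow> 'a) set" where "W = {g. finite {u. g u \<noteq> 0} \<and> {u. g u \<noteq> 0} \<subseteq> V}"
  define e :: "'v \<Rightarrow> 'v \<Rightarrow> 'a" where "e = (\<lambda>u x. if x = u then 1 else 0)"
  interpret F: vector_space ?s
    by (rule vector_space_fun)
  interpret FF: vector_space_pair ?s ?s
    by unfold_locales
  have linT: "Vector_Spaces.linear ?s ?s ?T"
    using vector_space_fun
    by (auto simp: Vector_Spaces.linear_iff shifted_adj_def fun_eq_iff sum.distrib sum_distrib_left algebra_simps)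
  have subW: "F.subspace W"
  proof (rule F.subspaceI)
    show "0 \<in> W" by (simp add: W_def)
    show "f + g \<in> W" if "f \<in> W" "g \<in> W" for f g
    proof -
      have "{u. (f + g) u \<noteq> 0} \<subseteq> {u. f u \<noteq> 0} \<union> {u. g u \<noteq> 0}" by auto
      with that show ?thesis
        unfolding W_def by (blast intro: finite_subset)
    qed
    show "?s c f \<in> W" if "f \<in> W" for c f
      using that by (auto simp: W_def elim: rev_finite_subset)
  qed
  obtain h where hW: "range h \<subseteq> W" and linh: "Vector_Spaces.linear ?s ?s h"
    and hT: "\<forall>y\<in>?T ` W. ?T (h y) = y"
    using FF.linear_exists_right_inverse_on[OF linT subW] by blast
  have agree: "h (?T g) v = g v" if g: "g \<in> W" for g
  proof -
    let ?d = "h (?T g) - g"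
    have dW: "?d \<in> W"
      using hW g by (intro F.subspace_diff[OF subW]) auto
    have "?T ?d = ?T (h (?T g)) - ?T g"
      by (rule FF.linear_diff[OF linT])
    also have "\<dots> = 0"
      using hT g by simp
    finally have "?d v = 0"
      using dW ker[of ?d] by (simp add: W_def)
    then show ?thesis by simp
  qed
  have "?T (\<lambda>u. h (e u) v) u = (if u = v then 1 else 0)" if u: "u \<in> V" for u
  proof -
    \<comment> \<open>Symmetry of the matrix of \<open>T\<close>: its column at \<open>u\<close> is the row defining \<open>T f u\<close>.\<close>
    have column: "?T (e u) = (\<Sum>w\<in>nbrs E u. e w) - ?s l (e u)"
    proof
      fix x
      show "?T (e u) x = ((\<Sum>w\<in>nbrs E u. e w) - ?s l (e u)) x"
        using u nbrs_subset[of u] locally_finite[of u] locally_finite[of x]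
        by (auto simp: shifted_adj_def e_def sum_fun_apply nbrs_sym[of u E x])
    qed
    have "h (?T (e u)) = (\<Sum>w\<in>nbrs E u. h (e w)) - ?s l (h (e u))"
      unfolding column
      by (simp add: FF.linear_diff[OF linh] FF.linear_sum[OF linh] FF.linear_scale[OF linh])
    then have "h (?T (e u)) v = (\<Sum>w\<in>nbrs E u. h (e w) v) - l * h (e u) v"
      by (simp add: sum_fun_apply)
    moreover have "h (?T (e u)) v = e u v"
      using u by (intro agree) (auto simp: W_def e_def)
    ultimately show ?thesis
      using u by (auto simp: shifted_adj_def e_def)
  qed
  then show ?thesis by blast
qed

theorem mainTheorem1:
  fixes V :: "'v set" and E :: "'v set set"
    and av :: "'a::field \<Rightarrow> real" and l :: 'a and v :: 'v
  assumes "locally_finite_graph V E"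
    and "absolute_value av"
    and "v \<in> V"
  shows "((\<exists>f. eigenfunction V E l f \<and> finite (supp V f) \<and> v \<in> supp V f)
            \<longleftrightarrow> \<not> (\<exists>f. propagator V E l v f))
       \<and> (\<not> (\<exists>f. propagator V E l v f) \<longleftrightarrow> v \<in> no_propagator_set V E l)"
proof -
  interpret locally_finite_graph V E by fact
  have "False" if f: "eigenfunction V E l f" "finite (supp V f)" "v \<in> supp V f"
    and p: "propagator V E l v p" for f p
  proof -
    define D where "D = supp V f \<union> (\<Union>u\<in>supp V f. nbrs E u)"
    have DV: "D \<subseteq> V"
      using nbrs_subset by (auto simp: D_def supp_def)
    have finD: "finite D"
      using f(2) locally_finite by (auto simp: D_def supp_def)
    have "f v = (\<Sum>u\<in>D. if u = v then f u else 0)"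
      using finD f(3) by (simp add: D_def)
    also have "\<dots> = (\<Sum>u\<in>D. f u * shifted_adj V E l p u)"
      using DV p by (intro sum.cong) (auto simp: propagator_iff)
    also have "\<dots> = (\<Sum>u\<in>D. shifted_adj V E l f u * p u)"
      unfolding D_def by (rule pairing_symmetric[OF f(2)])
    also have "\<dots> = 0"
      using DV f(1) by (intro sum.neutral) (auto simp: eigenfunction_iff)
    finally show False
      using f(3) by (simp add: supp_def)
  qed
  moreover have "\<exists>f. eigenfunction V E l f \<and> finite (supp V f) \<and> v \<in> supp V f"
    if none: "\<not> (\<exists>f. propagator V E l v f)"
  proof (rule ccontr)
    assume no_eigen: "\<not> ?thesis"
    have "g v = 0" if g: "finite {u. g u \<noteq> 0}" "{u. g u \<noteq> 0} \<subseteq> V"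
      "\<forall>u\<in>V. shifted_adj V E l g u = 0" for g
    proof (rule ccontr)
      assume "g v \<noteq> 0"
      moreover have "shifted_adj V E l (restrict g V) u = shifted_adj V E l g u" for u
        using nbrs_subset[of u] by (auto simp: shifted_adj_def intro!: sum.cong)
      moreover have "supp V (restrict g V) = {u. g u \<noteq> 0}"
        using g(2) by (auto simp: supp_def)
      ultimately have "eigenfunction V E l (restrict g V) \<and> finite (supp V (restrict g V))
          \<and> v \<in> supp V (restrict g V)"
        using g by (auto simp: eigenfunction_iff)
      with no_eigen show False by blast
    qed
    then obtain f where f: "\<forall>u\<in>V. shifted_adj V E l f u = (if u = v then 1 else 0)"
      using dual_solution_exists by blast
    have "shifted_adj V E l (restrict f V) u = shifted_adj V E l f u" for u
      using nbrs_subset[of u] by (auto simp: shifted_adj_def intro!: sum.cong)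
    with f have "propagator V E l v (restrict f V)"
      by (simp add: propagator_iff)
    with none show False by blast
  qed
  ultimately show ?thesis
    using assms(3) by (auto simp: no_propagator_set_def)
qed

end
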